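(* Let $m\ge 2$ and let $n\ge 665$ be odd. Let $G=A(m,n)$ be Adyan's group. (1) If $1\ne\alpha\in\mathsf{T}_{\bullet}(G)$, then $\alpha^n\notin\mathsf{T}_{\bullet}(G)$. In particular, the set of generalized torsion elements of a group need not be a subgroup. (2) The set of all commutators $\{[x,y]\mid x,y\in G\}$ is contained in $\mathsf{T}_{\bullet}(G)$.
   Context: Notation: $x^y=y^{-1}xy$ and $[x,y]=x^{-1}y^{-1}xy$. An element $g$ of a group $G$ is generalized torsion if there exist an integer $k\ge1$ and $x_1,\dots,x_k\in G$ with $g^{x_1}\cdots g^{x_k}=1$; the set of all such elements is $\mathsf{T}_{\bullet}(G)$. $B(m,n)$ denotes the free Burnside group on $m$ generators of exponent $n$, i.e. the quotient of the free group of rank $m$ by the subgroup generated by all $n$-th powers. For integers $m\ge2$ and $n\ge665$ odd, $A(m,n)$ denotes the group constructed by Adyan with the following properties: it is torsion-free, the intersection of any two non-trivial subgroups of it is non-trivial, and it is a central extension $1\to\mathbb{Z}\to A(m,n)\to B(m,n)\to1$ (the image of $\mathbb{Z}$ is a central subgroup $N$ with $A(m,n)/N\cong B(m,n)$). *)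

theory Defs
  imports "HOL-Algebra.Algebra"
begin

section \<open>Free groups and free Burnside groups\<close>

text \<open>The letter \<open>(i, False)\<close> is the generator \<open>x\<^sub>i\<close> and \<open>(i, True)\<close> is its formal inverse.\<close>

type_synonym letter = "nat \<times> bool"

definition inv_letter :: "letter \<Rightarrow> letter" where
  "inv_letter x = (fst x, \<not> snd x)"

definition reduced :: "letter list \<Rightarrow> bool" where
  "reduced w \<longleftrightarrow> successively (\<lambda>x y. y \<noteq> inv_letter x) w"

fun red_cons :: "letter \<Rightarrow> letter list \<Rightarrow> letter list" where
  "red_cons x [] = [x]"
| "red_cons x (y # ys) = (if y = inv_letter x then ys else x # y # ys)"

definition reduce :: "letter list \<Rightarrow> letter list" where
  "reduce w = foldr red_cons w []"

text \<open>The free group of rank \<open>m\<close> on the generators \<open>x\<^sub>0, \<dots>, x\<^bsub>m-1\<^esub>\<close>, realised by reduced words.\<close>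

definition free_group :: "nat \<Rightarrow> letter list monoid" where
  "free_group m =
     \<lparr>carrier = {w. fst ` set w \<subseteq> {..<m} \<and> reduced w},
      monoid.mult = (\<lambda>u v. reduce (u @ v)),
      one = []\<rparr>"

definition power_subgroup :: "('a, 'b) monoid_scheme \<Rightarrow> nat \<Rightarrow> 'a set" where
  "power_subgroup G n = generate G {g [^]\<^bsub>G\<^esub> n | g. g \<in> carrier G}"

definition free_burnside :: "nat \<Rightarrow> nat \<Rightarrow> letter list set monoid" where
  "free_burnside m n = free_group m Mod power_subgroup (free_group m) n"


subsection \<open>Well-definedness\<close>

lemma inv_letter_inv_letter [simp]: "inv_letter (inv_letter x) = x"
  by (simp add: inv_letter_def)

lemma fst_inv_letter [simp]: "fst (inv_letter x) = fst x"
  by (simp add: inv_letter_def)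

lemma reduced_Nil [simp]: "reduced []"
  by (simp add: reduced_def)

lemma reduced_ConsD: "reduced (x # w) \<Longrightarrow> reduced w"
  by (cases w) (auto simp: reduced_def)

lemma reduced_red_cons: "reduced w \<Longrightarrow> reduced (red_cons x w)"
  by (cases w) (auto simp: reduced_def dest: reduced_ConsD[unfolded reduced_def])

lemma reduced_foldr: "reduced v \<Longrightarrow> reduced (foldr red_cons u v)"
  by (induction u) (auto intro: reduced_red_cons)

lemma red_cons_cancel: "reduced w \<Longrightarrow> red_cons x (red_cons (inv_letter x) w) = w"
proof (cases w)
  case (Cons y ys)
  assume "reduced w"
  then show ?thesis
    using Cons by (cases ys) (auto simp: reduced_def)
qed simp

lemma foldr_red_cons_red_cons:
  "reduced v \<Longrightarrow> foldr red_cons (red_cons x u) v = red_cons x (foldr red_cons u v)"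
  by (cases u) (auto simp: red_cons_cancel reduced_foldr)

lemma foldr_reduce:
  "reduced v \<Longrightarrow> foldr red_cons (reduce u) v = foldr red_cons u v"
  by (induction u) (auto simp: reduce_def foldr_red_cons_red_cons)

lemma reduced_reduce [simp]: "reduced (reduce w)"
  by (simp add: reduce_def reduced_foldr)

lemma reduce_reduced: "reduced w \<Longrightarrow> reduce w = w"
proof (induction w)
  case (Cons x w)
  then have "reduce w = w" by (auto dest: reduced_ConsD)
  then show ?case using Cons.prems
    by (cases w) (auto simp: reduce_def reduced_def)
qed (simp add: reduce_def)

lemma reduce_append: "reduce (u @ v) = foldr red_cons u (reduce v)"
  by (simp add: reduce_def)

lemma reduce_append_left: "reduce (reduce u @ v) = reduce (u @ v)"
  by (simp add: reduce_append foldr_reduce)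

lemma reduce_append_right: "reduce (u @ reduce v) = reduce (u @ v)"
  by (simp add: reduce_append reduce_reduced)

lemma set_red_cons: "set (red_cons x w) \<subseteq> insert x (set w)"
  by (cases w) auto

lemma set_reduce: "set (reduce w) \<subseteq> set w"
proof (induction w)
  case (Cons x w)
  then show ?case
    using set_red_cons[of x "reduce w"] by (auto simp: reduce_def)
qed (simp add: reduce_def)

lemma reduce_inverse: "reduce (map inv_letter (rev w) @ w) = []"
proof (induction w)
  case (Cons x w)
  have "reduce (map inv_letter (rev (x # w)) @ x # w)
      = foldr red_cons (map inv_letter (rev w)) (red_cons (inv_letter x) (red_cons x (reduce w)))"
    by (simp add: reduce_def)
  also have "red_cons (inv_letter x) (red_cons x (reduce w)) = reduce w"
    using red_cons_cancel[of "reduce w" "inv_letter x"] by simp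
  finally show ?case
    using Cons by (simp add: reduce_append)
qed (simp add: reduce_def)

lemma group_free_group: "group (free_group m)"
proof (rule groupI)
  fix u v assume uv: "u \<in> carrier (free_group m)" "v \<in> carrier (free_group m)"
  then have "fst ` set (reduce (u @ v)) \<subseteq> {..<m}"
    using set_reduce[of "u @ v"] by (fastforce simp: free_group_def)
  then show "u \<otimes>\<^bsub>free_group m\<^esub> v \<in> carrier (free_group m)"
    by (simp add: free_group_def)
next
  fix u assume u: "u \<in> carrier (free_group m)"
  let ?v = "reduce (map inv_letter (rev u))"
  have "fst ` set (map inv_letter (rev u)) \<subseteq> {..<m}"
    using u by (auto simp: free_group_def)
  then have "fst ` set ?v \<subseteq> {..<m}"
    using set_reduce[of "map inv_letter (rev u)"] by blast
  then have "?v \<in> carrier (free_group m)"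
    by (simp add: free_group_def)
  moreover have "?v \<otimes>\<^bsub>free_group m\<^esub> u = \<one>\<^bsub>free_group m\<^esub>"
    by (simp add: free_group_def reduce_append_left reduce_inverse)
  ultimately show "\<exists>v\<in>carrier (free_group m). v \<otimes>\<^bsub>free_group m\<^esub> u = \<one>\<^bsub>free_group m\<^esub>"
    by blast
qed (auto simp: free_group_def reduce_append_left reduce_append_right reduce_reduced)

lemma (in group) pow_conj:
  assumes "g \<in> carrier G" "h \<in> carrier G"
  shows "(h \<otimes> g \<otimes> inv h) [^] (n::nat) = h \<otimes> g [^] n \<otimes> inv h"
proof (induction n)
  case (Suc n)
  have "inv h \<otimes> (h \<otimes> (g \<otimes> inv h)) = g \<otimes> inv h"
    using assms by (simp flip: m_assoc)
  then have "(h \<otimes> g [^] n \<otimes> inv h) \<otimes> (h \<otimes> g \<otimes> inv h) = h \<otimes> g [^] n \<otimes> (inv h \<otimes> h) \<otimes> g \<otimes> inv h"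
    using assms by (simp add: m_assoc)
  then show ?case
    using Suc assms by (simp add: m_assoc)
qed (use assms in simp)

lemma (in group) normal_power_subgroup: "power_subgroup G n \<lhd> G"
  unfolding power_subgroup_def
proof (rule normal_generateI)
  fix h g assume "h \<in> {g [^] n | g. g \<in> carrier G}" and g: "g \<in> carrier G"
  then obtain k where "k \<in> carrier G" "h = k [^] n" by auto
  then have "g \<otimes> h \<otimes> inv g = (g \<otimes> k \<otimes> inv g) [^] n" "g \<otimes> k \<otimes> inv g \<in> carrier G"
    using g by (simp_all add: pow_conj)
  then show "g \<otimes> h \<otimes> inv g \<in> {g [^] n | g. g \<in> carrier G}" by blast
qed auto

lemma group_free_burnside: "group (free_burnside m n)"
  unfolding free_burnside_def
  by (intro normal.factorgroup_is_group group.normal_power_subgroup group_free_group)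


section \<open>Generalized torsion and commutators\<close>

text \<open>The convention for conjugates is \<open>g\<^sup>x = x\<inverse> g x\<close>.\<close>

definition conjugate :: "('a, 'b) monoid_scheme \<Rightarrow> 'a \<Rightarrow> 'a \<Rightarrow> 'a" where
  "conjugate G g x = inv\<^bsub>G\<^esub> x \<otimes>\<^bsub>G\<^esub> g \<otimes>\<^bsub>G\<^esub> x"

definition commutator :: "('a, 'b) monoid_scheme \<Rightarrow> 'a \<Rightarrow> 'a \<Rightarrow> 'a" where
  "commutator G x y = inv\<^bsub>G\<^esub> x \<otimes>\<^bsub>G\<^esub> inv\<^bsub>G\<^esub> y \<otimes>\<^bsub>G\<^esub> x \<otimes>\<^bsub>G\<^esub> y"

text \<open>The list \<open>xs = [x\<^sub>1, \<dots>, x\<^sub>k]\<close> is the sequence of conjugators; \<open>xs \<noteq> []\<close> says \<open>k \<ge> 1\<close>, and the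
  \<open>foldr\<close> is the ordered product of the conjugates.\<close>

definition generalized_torsion :: "('a, 'b) monoid_scheme \<Rightarrow> 'a set" where
  "generalized_torsion G =
     {g \<in> carrier G. \<exists>xs. xs \<noteq> [] \<and> set xs \<subseteq> carrier G \<and>
        foldr (\<otimes>\<^bsub>G\<^esub>) (map (conjugate G g) xs) \<one>\<^bsub>G\<^esub> = \<one>\<^bsub>G\<^esub>}"


section \<open>Adyan's groups\<close>

definition torsion_free_group :: "('a, 'b) monoid_scheme \<Rightarrow> bool" where
  "torsion_free_group G \<longleftrightarrow>
     (\<forall>g\<in>carrier G. \<forall>k::nat. k \<ge> 1 \<longrightarrow> g [^]\<^bsub>G\<^esub> k = \<one>\<^bsub>G\<^esub> \<longrightarrow> g = \<one>\<^bsub>G\<^esub>)"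

text \<open>A central extension \<open>1 \<rightarrow> A \<rightarrow> G \<rightarrow> Q \<rightarrow> 1\<close>. (The library's \<open>short_exact_sequence\<close> would force
  the three groups to have the same element type.)\<close>

definition central_extension ::
    "('a, 'b) monoid_scheme \<Rightarrow> ('c, 'd) monoid_scheme \<Rightarrow> ('e, 'f) monoid_scheme \<Rightarrow> bool" where
  "central_extension A G Q \<longleftrightarrow>
     (\<exists>\<iota> \<pi>. \<iota> \<in> mon A G \<and> \<pi> \<in> epi G Q \<and> kernel G Q \<pi> = \<iota> ` carrier A \<and>
        (\<forall>z\<in>\<iota> ` carrier A. \<forall>g\<in>carrier G. z \<otimes>\<^bsub>G\<^esub> g = g \<otimes>\<^bsub>G\<^esub> z))"

text \<open>\<open>adyan_group m n G\<close> states the properties of \<open>G = A(m,n)\<close>. Adyan proved that, for \<open>m \<ge> 2\<close>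
  and odd \<open>n \<ge> 665\<close>, a group with these properties exists.\<close>

definition adyan_group :: "nat \<Rightarrow> nat \<Rightarrow> ('a, 'b) monoid_scheme \<Rightarrow> bool" where
  "adyan_group m n G \<longleftrightarrow>
     group G \<and>
     torsion_free_group G \<and>
     (\<forall>H K. subgroup H G \<longrightarrow> subgroup K G \<longrightarrow> H \<noteq> {\<one>\<^bsub>G\<^esub>} \<longrightarrow> K \<noteq> {\<one>\<^bsub>G\<^esub>} \<longrightarrow> H \<inter> K \<noteq> {\<one>\<^bsub>G\<^esub>}) \<and>
     central_extension integer_group G (free_burnside m n)"

end

theory Submission
  imports Defs
begin

text \<open>In the quotient by the central copy of the integers every element has exponent \<open>n\<close>, so \<open>n\<close>-th
  powers in \<open>G\<close> are central. A central generalized torsion element is a torsion element, which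
  gives the first claim. For \<open>c = [x, y] = x\<inverse> x\<^sup>y\<close> the product of the conjugates of \<open>c\<close> by
  \<open>1, y, \<dots>, y^(n-1)\<close> telescopes to \<open>x\<inverse> (y^n)\<inverse> x y^n\<close>, which is trivial because \<open>y^n\<close> is central.
  Finally \<open>G\<close> has a nontrivial commutator, since \<open>B(m,n)\<close> maps onto the Heisenberg group modulo
  \<open>n\<close>, which has exponent \<open>n\<close> because \<open>n\<close> is odd.\<close>

section \<open>Homomorphisms out of the free group\<close>

fun word_value :: "('a, 'b) monoid_scheme \<Rightarrow> (nat \<Rightarrow> 'a) \<Rightarrow> letter list \<Rightarrow> 'a" where
  "word_value H f [] = \<one>\<^bsub>H\<^esub>"
| "word_value H f (x # w) =
     (if snd x then inv\<^bsub>H\<^esub> f (fst x) else f (fst x)) \<otimes>\<^bsub>H\<^esub> word_value H f w"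

context group
begin

lemma word_value_closed:
  assumes "\<And>i. f i \<in> carrier G"
  shows "word_value G f w \<in> carrier G"
  by (induction w) (use assms in auto)

lemma word_value_append:
  assumes "\<And>i. f i \<in> carrier G"
  shows "word_value G f (u @ v) = word_value G f u \<otimes> word_value G f v"
  by (induction u) (use assms in \<open>auto simp: word_value_closed m_assoc\<close>)

text \<open>\<open>red_cons\<close> differs from \<open>#\<close> only when it cancels a letter
  against its formal inverse, and the values of these two multiply to the identity.\<close>

lemma word_value_red_cons:
  assumes "\<And>i. f i \<in> carrier G"
  shows "word_value G f (red_cons x w) = word_value G f (x # w)"
proof (cases w)
  case (Cons y ys)
  then show ?thesis
    using assms by (auto simp: inv_letter_def word_value_closed simp flip: m_assoc)
qed simp

lemma word_value_reduce:
  assumes "\<And>i. f i \<in> carrier G"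
  shows "word_value G f (reduce w) = word_value G f w"
proof (induction w)
  case (Cons x w)
  then show ?case
    using word_value_red_cons[where f = f and x = x and w = "reduce w"] assms by (simp add: reduce_def)
qed (simp add: reduce_def)

text \<open>The existence half of the universal property of the free group. Requiring
  \<open>f i\<close> in the carrier for every \<open>i\<close> lets closure hold for all words, with
  no bound on their letters.\<close>

lemma word_value_hom:
  assumes "\<And>i. f i \<in> carrier G"
  shows "word_value G f \<in> hom (free_group m) G"
  using assms
  by (auto intro!: homI simp: free_group_def word_value_closed word_value_reduce word_value_append)

end

text \<open>A generator \<open>g^n\<close> goes to \<open>(h g)^n\<close>, and \<open>S\<close>
  absorbs products and inverses. Conversely, an element whose image lies outside \<open>S\<close> is
  not in the power subgroup, which is how non-commutativity is detected below.\<close>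

lemma power_subgroup_hom_image:
  assumes "group_hom G H h" "subgroup S H"
    and "\<And>g. g \<in> carrier H \<Longrightarrow> g [^]\<^bsub>H\<^esub> n \<in> S"
    and "p \<in> power_subgroup G n"
  shows "h p \<in> S"
proof -
  interpret group_hom G H h by fact
  from assms(4) show ?thesis
    unfolding power_subgroup_def
  proof (induction rule: generate.induct)
    case one
    then show ?case using assms(2) by (simp add: subgroup.one_closed)
  next
    case (incl g)
    then show ?case using assms(3) by (auto simp: hom_nat_pow)
  next
    case (inv g)
    then show ?case using assms(2,3)
      by (auto simp: hom_nat_pow subgroup.m_inv_closed simp flip: H.nat_pow_inv)
  next
    case (eng g k)
    moreover have "generate G {g [^]\<^bsub>G\<^esub> n |g. g \<in> carrier G} \<subseteq> carrier G"
      by (rule G.generate_incl) auto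
    ultimately show ?case using assms(2) by (simp add: subgroup.m_closed subset_iff)
  qed
qed

section \<open>The integral Heisenberg group and its n-th powers\<close>

text \<open>\<open>(a, b, c)\<close> stands for the upper unitriangular 3 by 3 matrix with
  \<open>a\<close>, \<open>b\<close> next to the diagonal and \<open>c\<close> in the
  corner.\<close>

definition heisenberg_group :: "(int \<times> int \<times> int) monoid" where
  "heisenberg_group =
     \<lparr>carrier = UNIV,
      monoid.mult = (\<lambda>(a, b, c) (a', b', c'). (a + a', b + b', c + c' + a * b')),
      one = (0, 0, 0)\<rparr>"

lemma heisenberg_simps [simp]:
  "carrier heisenberg_group = UNIV"
  "(a, b, c) \<otimes>\<^bsub>heisenberg_group\<^esub> (a', b', c') = (a + a', b + b', c + c' + a * b')"
  "\<one>\<^bsub>heisenberg_group\<^esub> = (0, 0, 0)"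
  by (simp_all add: heisenberg_group_def)

lemma group_heisenberg: "group heisenberg_group"
proof (rule groupI)
  fix x assume "x \<in> carrier heisenberg_group"
  obtain a b c where "x = (a, b, c)" by (cases x)
  then have "(-a, -b, -c + a * b) \<otimes>\<^bsub>heisenberg_group\<^esub> x = \<one>\<^bsub>heisenberg_group\<^esub>"
    by simp
  then show "\<exists>y\<in>carrier heisenberg_group. y \<otimes>\<^bsub>heisenberg_group\<^esub> x = \<one>\<^bsub>heisenberg_group\<^esub>"
    by (metis UNIV_I heisenberg_simps(1))
qed (auto simp: algebra_simps)

lemma heisenberg_inv:
  "inv\<^bsub>heisenberg_group\<^esub> (a, b, c) = (-a, -b, -c + a * b)"
  by (rule group.inv_equality[OF group_heisenberg]) auto

text \<open>The central coordinate is doubled to avoid dividing by two.\<close>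

lemma heisenberg_pow:
  "\<exists>d. (a, b, c) [^]\<^bsub>heisenberg_group\<^esub> k = (int k * a, int k * b, d) \<and>
     2 * d = int k * (2 * c + (int k - 1) * (a * b))"
proof (induction k)
  case (Suc k)
  then obtain d where "(a, b, c) [^]\<^bsub>heisenberg_group\<^esub> k = (int k * a, int k * b, d)"
    "2 * d = int k * (2 * c + (int k - 1) * (a * b))" by blast
  then show ?case
    by (auto simp: monoid.nat_pow_Suc[OF group.is_monoid[OF group_heisenberg]] algebra_simps)
qed (simp add: monoid.nat_pow_0[OF group.is_monoid[OF group_heisenberg]])

text \<open>The kernel of reduction modulo \<open>n\<close>. Working with it inside the integral
  group replaces the construction of the Heisenberg group modulo \<open>n\<close>.\<close>

definition heisenberg_multiples :: "nat \<Rightarrow> (int \<times> int \<times> int) set" where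
  "heisenberg_multiples n = {(a, b, c). int n dvd a \<and> int n dvd b \<and> int n dvd c}"

lemma subgroup_heisenberg_multiples: "subgroup (heisenberg_multiples n) heisenberg_group"
  by (rule group.subgroupI[OF group_heisenberg])
    (auto simp: heisenberg_multiples_def heisenberg_inv intro!: exI[of _ 0])

lemma heisenberg_pow_multiples:
  assumes "odd n"
  shows "x [^]\<^bsub>heisenberg_group\<^esub> n \<in> heisenberg_multiples n"
proof -
  obtain a b c where x: "x = (a, b, c)" by (cases x)
  obtain d where d: "(a, b, c) [^]\<^bsub>heisenberg_group\<^esub> n = (int n * a, int n * b, d)"
    "2 * d = int n * (2 * c + (int n - 1) * (a * b))"
    using heisenberg_pow by blast
  have "int n dvd 2 * d" by (simp add: d(2))
  \<comment> \<open>Oddness is essential here: for \<open>n = 2\<close> the square of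
    \<open>(1, 1, 0)\<close> is \<open>(2, 2, 1)\<close>.\<close>
  moreover have "coprime (int n) 2" using assms by simp
  ultimately have "int n dvd d" by (simp add: coprime_dvd_mult_right_iff)
  then show ?thesis by (simp add: x d(1) heisenberg_multiples_def)
qed

section \<open>Exponent and non-commutativity of the free Burnside group\<close>

lemma power_subgroup_pow_in:
  "g \<in> carrier G \<Longrightarrow> g [^]\<^bsub>G\<^esub> n \<in> power_subgroup G n"
  unfolding power_subgroup_def by (blast intro: generate.incl)

lemma free_burnside_exponent:
  assumes "q \<in> carrier (free_burnside m n)"
  shows "q [^]\<^bsub>free_burnside m n\<^esub> n = \<one>\<^bsub>free_burnside m n\<^esub>"
proof -
  let ?F = "free_group m"
  interpret N: normal "power_subgroup ?F n" ?F
    by (rule group.normal_power_subgroup[OF group_free_group])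
  interpret \<pi>: group_hom ?F "?F Mod power_subgroup ?F n" "\<lambda>g. power_subgroup ?F n #>\<^bsub>?F\<^esub> g"
    using N.r_coset_hom_Mod N.factorgroup_is_group
    by (simp add: group_hom_def group_hom_axioms_def group_free_group)
  obtain g where g: "g \<in> carrier ?F" "q = power_subgroup ?F n #>\<^bsub>?F\<^esub> g"
    using assms by (auto simp: free_burnside_def FactGroup_def RCOSETS_def)
  have "q [^]\<^bsub>free_burnside m n\<^esub> n = power_subgroup ?F n #>\<^bsub>?F\<^esub> (g [^]\<^bsub>?F\<^esub> n)"
    using g \<pi>.hom_nat_pow by (simp add: free_burnside_def)
  also have "\<dots> = power_subgroup ?F n"
    by (rule N.rcos_const[OF group_free_group power_subgroup_pow_in[OF g(1)]])
  finally show ?thesis by (simp add: free_burnside_def FactGroup_def)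
qed

text \<open>The first two generators are sent to Heisenberg matrices that do not commute modulo
  \<open>n\<close>. If their cosets commuted, the quotient of \<open>x y\<close> by
  \<open>y x\<close> would lie in the power subgroup, so its image \<open>(0, 0, 1)\<close> would be
  divisible by \<open>n > 1\<close>.\<close>

lemma free_burnside_nonabelian:
  assumes "m \<ge> 2" "odd n" "n > 1"
  shows "\<exists>p\<in>carrier (free_burnside m n). \<exists>q\<in>carrier (free_burnside m n).
           p \<otimes>\<^bsub>free_burnside m n\<^esub> q \<noteq> q \<otimes>\<^bsub>free_burnside m n\<^esub> p"
proof -
  define F where "F = free_group m"
  let ?P = "power_subgroup F n"
  interpret N: normal ?P F
    unfolding F_def by (rule group.normal_power_subgroup[OF group_free_group])
  \<comment> \<open>\<open>f\<close> must be total, so every index beyond 1 also receives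
    \<open>(0, 1, 0)\<close>.\<close>
  define f :: "nat \<Rightarrow> int \<times> int \<times> int" where "f i = (if i = 0 then (1, 0, 0) else (0, 1, 0))" for i
  define \<phi> where "\<phi> = word_value heisenberg_group f"
  interpret group_hom F heisenberg_group \<phi>
    using group.word_value_hom[OF group_heisenberg, of f m]
    by (simp add: group_hom_def group_hom_axioms_def group_heisenberg \<phi>_def F_def group_free_group)
  define x y :: "letter list" where "x = [(0, False)]" and "y = [(1, False)]"
  have xy: "x \<in> carrier F" "y \<in> carrier F"
    using assms(1) by (auto simp: F_def x_def y_def free_group_def reduced_def)
  have "\<phi> x = (1, 0, 0)" "\<phi> y = (0, 1, 0)"
    by (simp_all add: \<phi>_def x_def y_def f_def)
  then have \<phi>: "\<phi> ((x \<otimes>\<^bsub>F\<^esub> y) \<otimes>\<^bsub>F\<^esub> inv\<^bsub>F\<^esub> (y \<otimes>\<^bsub>F\<^esub> x)) = (0, 0, 1)"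
    using xy by (simp add: heisenberg_inv del: N.inv_mult_group)
  have "?P #>\<^bsub>F\<^esub> (x \<otimes>\<^bsub>F\<^esub> y) \<noteq> ?P #>\<^bsub>F\<^esub> (y \<otimes>\<^bsub>F\<^esub> x)"
  proof
    assume "?P #>\<^bsub>F\<^esub> (x \<otimes>\<^bsub>F\<^esub> y) = ?P #>\<^bsub>F\<^esub> (y \<otimes>\<^bsub>F\<^esub> x)"
    then have "x \<otimes>\<^bsub>F\<^esub> y \<in> ?P #>\<^bsub>F\<^esub> (y \<otimes>\<^bsub>F\<^esub> x)"
      using xy N.rcos_self N.is_subgroup by blast
    then have "(x \<otimes>\<^bsub>F\<^esub> y) \<otimes>\<^bsub>F\<^esub> inv\<^bsub>F\<^esub> (y \<otimes>\<^bsub>F\<^esub> x) \<in> ?P"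
      using xy N.rcos_module_imp by simp
    then have "(0, 0, 1) \<in> heisenberg_multiples n"
      using power_subgroup_hom_image[OF group_hom_axioms subgroup_heisenberg_multiples] \<phi>
        heisenberg_pow_multiples[OF assms(2)] by metis
    then show False using assms(3) by (simp add: heisenberg_multiples_def)
  qed
  then have "(?P #>\<^bsub>F\<^esub> x) \<otimes>\<^bsub>F Mod ?P\<^esub> (?P #>\<^bsub>F\<^esub> y) \<noteq> (?P #>\<^bsub>F\<^esub> y) \<otimes>\<^bsub>F Mod ?P\<^esub> (?P #>\<^bsub>F\<^esub> x)"
    using xy by (simp add: N.rcos_sum)
  moreover have "?P #>\<^bsub>F\<^esub> x \<in> carrier (F Mod ?P)" "?P #>\<^bsub>F\<^esub> y \<in> carrier (F Mod ?P)"
    using xy by (auto simp: FactGroup_def RCOSETS_def)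
  ultimately show ?thesis unfolding free_burnside_def F_def by blast
qed

section \<open>Passing between a central extension and its quotient\<close>

text \<open>The projection kills \<open>g^n\<close> because the quotient satisfies the exponent law,
  and its kernel is central.\<close>

lemma central_extension_central:
  assumes "central_extension A G Q" "group G" "group Q" "g \<in> carrier G"
    and "\<And>q. q \<in> carrier Q \<Longrightarrow> q [^]\<^bsub>Q\<^esub> n = \<one>\<^bsub>Q\<^esub>" and "h \<in> carrier G"
  shows "g [^]\<^bsub>G\<^esub> (n::nat) \<otimes>\<^bsub>G\<^esub> h = h \<otimes>\<^bsub>G\<^esub> g [^]\<^bsub>G\<^esub> n"
proof -
  obtain \<iota> \<pi> where \<pi>: "\<pi> \<in> epi G Q" "kernel G Q \<pi> = \<iota> ` carrier A"
    and central: "\<And>z h. z \<in> \<iota> ` carrier A \<Longrightarrow> h \<in> carrier G \<Longrightarrow> z \<otimes>\<^bsub>G\<^esub> h = h \<otimes>\<^bsub>G\<^esub> z"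
    using assms(1) unfolding central_extension_def by blast
  interpret group_hom G Q \<pi>
    using \<pi>(1) assms(2,3) by (simp add: group_hom_def group_hom_axioms_def epi_def)
  have "g [^]\<^bsub>G\<^esub> n \<in> kernel G Q \<pi>"
    using assms(4,5) by (simp add: kernel_def hom_nat_pow)
  then show ?thesis using \<pi>(2) central assms(6) by simp
qed

text \<open>Used in contrapositive form: a non-commuting pair in the Burnside group yields one in
  \<open>G\<close>.\<close>

lemma epi_comm:
  assumes "\<pi> \<in> epi G Q"
    and "\<And>x y. x \<in> carrier G \<Longrightarrow> y \<in> carrier G \<Longrightarrow> x \<otimes>\<^bsub>G\<^esub> y = y \<otimes>\<^bsub>G\<^esub> x"
    and "p \<in> carrier Q" "q \<in> carrier Q"
  shows "p \<otimes>\<^bsub>Q\<^esub> q = q \<otimes>\<^bsub>Q\<^esub> p"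
proof -
  obtain x y where "x \<in> carrier G" "y \<in> carrier G" "p = \<pi> x" "q = \<pi> y" "\<pi> \<in> hom G Q"
    using assms(1,3,4) unfolding epi_def by blast
  then show ?thesis using assms(2) by (metis hom_mult)
qed

section \<open>Commutators and generalized torsion in an arbitrary group\<close>

context group
begin

lemma commutator_closed:
  "x \<in> carrier G \<Longrightarrow> y \<in> carrier G \<Longrightarrow> commutator G x y \<in> carrier G"
  by (simp add: commutator_def)

lemma commutator_eq_one_imp_comm:
  assumes "x \<in> carrier G" "y \<in> carrier G" "commutator G x y = \<one>"
  shows "x \<otimes> y = y \<otimes> x"
proof -
  have "inv (y \<otimes> x) \<otimes> (x \<otimes> y) = \<one>"
    using assms by (simp add: commutator_def inv_mult_group m_assoc)
  then show ?thesis
    using assms(1,2) by (metis inv_solve_left m_closed one_closed r_one)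
qed

lemma conjugate_central:
  assumes "g \<in> carrier G" "x \<in> carrier G" "g \<otimes> x = x \<otimes> g"
  shows "conjugate G g x = g"
  using assms by (simp add: conjugate_def m_assoc) (simp flip: m_assoc)

text \<open>Every conjugate of a central \<open>g\<close> is \<open>g\<close> itself, so a product
  of conjugates is a power whose exponent is the length of the nonempty list of conjugators.\<close>

lemma central_generalized_torsion:
  assumes "g \<in> generalized_torsion G"
    and "\<And>h. h \<in> carrier G \<Longrightarrow> g \<otimes> h = h \<otimes> g"
  shows "\<exists>k\<ge>1. g [^] (k::nat) = \<one>"
proof -
  obtain xs where g: "g \<in> carrier G" and xs: "xs \<noteq> []" "set xs \<subseteq> carrier G"
    and prod: "foldr (\<otimes>) (map (conjugate G g) xs) \<one> = \<one>"
    using assms(1) unfolding generalized_torsion_def by blast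
  have "foldr (\<otimes>) (map (conjugate G g) xs) \<one> = g [^] length xs"
    using xs(2)
  proof (induction xs)
    case (Cons x xs)
    then show ?case
      using g assms(2) by (simp add: conjugate_central nat_pow_mult[of g 1, simplified])
  qed simp
  then show ?thesis using prod xs(1) by (metis One_nat_def Suc_leI length_greater_0_conv)
qed

text \<open>Extending \<open>[0..<k]\<close> to \<open>[0..<Suc k]\<close> moves the new last factor
  into the seed of \<open>foldr\<close>; this splits it off again.\<close>

lemma foldr_mult_append:
  assumes "set us \<subseteq> carrier G" "z \<in> carrier G"
  shows "foldr (\<otimes>) us z = foldr (\<otimes>) us \<one> \<otimes> z"
proof -
  have "foldr (\<otimes>) us \<one> \<in> carrier G" if "set us \<subseteq> carrier G" for us
    using that by (induction us) auto
  then show ?thesis using assms by (induction us) (auto simp: m_assoc)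
qed

lemma conjugate_closed:
  "g \<in> carrier G \<Longrightarrow> x \<in> carrier G \<Longrightarrow> conjugate G g x \<in> carrier G"
  by (simp add: conjugate_def)

text \<open>Conjugation by \<open>y^k\<close> is applied to both factors of
  \<open>[x, y] = x^-1 * x^y\<close>. The result is a quotient of consecutive terms, ready to
  telescope.\<close>

lemma commutator_conjugate_pow:
  assumes "x \<in> carrier G" "y \<in> carrier G"
  shows "conjugate G (commutator G x y) (y [^] (k::nat))
       = inv (conjugate G x (y [^] k)) \<otimes> conjugate G x (y [^] Suc k)"
proof -
  let ?z = "y [^] k"
  have z: "?z \<in> carrier G" using assms by simp
  \<comment> \<open>Conjugating \<open>x^y\<close> by \<open>y^k\<close> gives the conjugator
    \<open>y * y^k\<close>, whereas \<open>y [^] Suc k\<close> unfolds to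
    \<open>y^k * y\<close>.\<close>
  have "y \<otimes> ?z = ?z \<otimes> y" using assms by (metis nat_pow_Suc nat_pow_Suc2)
  moreover from this have "inv y \<otimes> inv ?z = inv ?z \<otimes> inv y"
    using assms z by (metis inv_mult_group)
  ultimately show ?thesis
    using assms z by (simp add: conjugate_def commutator_def inv_mult_group m_assoc)
      (metis assms inv_closed m_assoc m_closed r_inv l_inv l_one z)
qed

text \<open>The product telescopes: the conjugator \<open>y^0\<close> leaves \<open>inv x\<close> at
  the left end, and the last conjugator \<open>y^(k-1)\<close> leaves the conjugate by
  \<open>y^k\<close> at the right end.\<close>

lemma prod_commutator_conjugates:
  assumes "x \<in> carrier G" "y \<in> carrier G"
  shows "foldr (\<otimes>) (map (conjugate G (commutator G x y)) (map (\<lambda>i. y [^] i) [0..<k])) \<one>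
       = inv x \<otimes> conjugate G x (y [^] k)"
proof (induction k)
  case (Suc k)
  let ?c = "conjugate G (commutator G x y)"
  have "foldr (\<otimes>) (map ?c (map (\<lambda>i. y [^] i) [0..<Suc k])) \<one>
      = foldr (\<otimes>) (map ?c (map (\<lambda>i. y [^] i) [0..<k])) (?c (y [^] k))"
    using assms by (simp add: conjugate_closed commutator_closed)
  also have "\<dots> = inv x \<otimes> conjugate G x (y [^] k) \<otimes> ?c (y [^] k)"
    using assms Suc.IH
    by (subst foldr_mult_append) (auto simp: conjugate_closed commutator_closed)
  also have "\<dots> = inv x \<otimes> conjugate G x (y [^] Suc k)"
  proof -
    let ?a = "conjugate G x (y [^] k)" and ?b = "conjugate G x (y [^] Suc k)"
    have "?a \<in> carrier G" "?b \<in> carrier G"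
      using assms by (simp_all add: conjugate_closed del: nat_pow_Suc)
    then have "?a \<otimes> (inv ?a \<otimes> ?b) = ?b" by (simp flip: m_assoc)
    then show ?thesis
      using assms \<open>?a \<in> carrier G\<close> \<open>?b \<in> carrier G\<close>
      by (simp add: commutator_conjugate_pow m_assoc del: nat_pow_Suc)
  qed
  finally show ?case .
qed (use assms in \<open>simp add: conjugate_def\<close>)

text \<open>When \<open>y^k\<close> commutes with \<open>x\<close>, the telescoped product is
  \<open>inv x * x\<close>; \<open>k \<ge> 1\<close> makes the list of conjugators nonempty.\<close>

lemma commutator_generalized_torsion:
  assumes "x \<in> carrier G" "y \<in> carrier G" "k \<ge> 1" "x \<otimes> y [^] (k::nat) = y [^] k \<otimes> x"
  shows "commutator G x y \<in> generalized_torsion G"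
proof -
  let ?xs = "map (\<lambda>i. y [^] i) [0..<k]"
  have "foldr (\<otimes>) (map (conjugate G (commutator G x y)) ?xs) \<one> = \<one>"
    using prod_commutator_conjugates[OF assms(1,2), of k] assms by (simp add: conjugate_central)
  moreover have "?xs \<noteq> []" "set ?xs \<subseteq> carrier G" using assms by auto
  ultimately show ?thesis
    unfolding generalized_torsion_def using assms(1,2) commutator_closed by blast
qed

end

theorem proposition2p4:
  fixes G :: "('a, 'b) monoid_scheme" (structure)
    and m n :: nat
  assumes "m \<ge> 2" and "n \<ge> 665" and "odd n"
    and "adyan_group m n G"
  shows "(\<forall>\<alpha>. \<alpha> \<noteq> \<one> \<longrightarrow> \<alpha> \<in> generalized_torsion G \<longrightarrow> \<alpha> [^] n \<notin> generalized_torsion G)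
       \<and> \<not> subgroup (generalized_torsion G) G
       \<and> {commutator G x y | x y. x \<in> carrier G \<and> y \<in> carrier G} \<subseteq> generalized_torsion G"
proof -
  interpret group G using assms(4) by (simp add: adyan_group_def)
  have torsion_free: "g = \<one>" if "g \<in> carrier G" "k \<ge> 1" "g [^] k = \<one>" for g and k :: nat
    using assms(4) that unfolding adyan_group_def torsion_free_group_def by blast
  have ext: "central_extension integer_group G (free_burnside m n)"
    using assms(4) by (simp add: adyan_group_def)
  have central: "g [^] n \<otimes> h = h \<otimes> g [^] n" if "g \<in> carrier G" "h \<in> carrier G" for g h
    using central_extension_central[OF ext _ group_free_burnside] free_burnside_exponent that
      group_axioms by blast
  have pow: "\<alpha> [^] n \<notin> generalized_torsion G"
    if "\<alpha> \<noteq> \<one>" "\<alpha> \<in> generalized_torsion G" for \<alpha>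
  proof
    have \<alpha>: "\<alpha> \<in> carrier G" using that(2) by (simp add: generalized_torsion_def)
    assume "\<alpha> [^] n \<in> generalized_torsion G"
    \<comment> \<open>Since \<open>\<alpha>^n\<close> is central, generalized torsion becomes
      ordinary torsion; torsion-freeness is then applied twice, to \<open>\<alpha>^n\<close> and to
      \<open>\<alpha>\<close>.\<close>
    then obtain k :: nat where "k \<ge> 1" "(\<alpha> [^] n) [^] k = \<one>"
      using central_generalized_torsion central \<alpha> by blast
    then have "\<alpha> [^] n = \<one>" using torsion_free \<alpha> by blast
    then have "\<alpha> = \<one>" using torsion_free[of \<alpha> n] \<alpha> assms(2) by simp
    then show False using that(1) by simp
  qed
  have comm: "commutator G x y \<in> generalized_torsion G" if "x \<in> carrier G" "y \<in> carrier G" for x y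
    using commutator_generalized_torsion[OF that, of n] central[OF that(2,1)] assms(2) by simp
  obtain \<pi> where "\<pi> \<in> epi G (free_burnside m n)"
    using ext unfolding central_extension_def by blast
  then obtain x y where xy: "x \<in> carrier G" "y \<in> carrier G" "x \<otimes> y \<noteq> y \<otimes> x"
    using free_burnside_nonabelian[OF assms(1,3)] epi_comm[of \<pi> G "free_burnside m n"] assms(2)
    by force
  have "\<not> subgroup (generalized_torsion G) G"
  proof
    assume "subgroup (generalized_torsion G) G"
    then interpret T: subgroup "generalized_torsion G" G .
    \<comment> \<open>\<open>?c\<close> is nontrivial because \<open>x\<close> and \<open>y\<close>
      do not commute. A subgroup containing it would also contain its n-th power, against
      \<open>pow\<close>.\<close>
    let ?c = "commutator G x y"
    have "?c [^] k \<in> generalized_torsion G" for k :: nat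
      by (induction k) (simp_all add: comm xy)
    then show False using pow[of ?c] comm commutator_eq_one_imp_comm xy by blast
  qed
  then show ?thesis using pow comm by blast
qed

end
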